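(* Let $m\ge 1$ and $n = 2m+1$. Given a universal cycle of the maximum ordered matchings of $K_n$ (i.e. of $\mathcal{M}_m(K_n)$), a $2$-by-$\frac{n!}{2}$ shorthand universal torus for the permutations of $\{0,\ldots,n-1\}$, with $2$-by-$m$ windows, can be generated in amortized $\mathcal{O}(1)$-time per column using additional space polynomial in $n$.
   Context: $K_n$ is the complete graph on $\{0,\ldots,n-1\}$. An ordered matching of size $m$ in $K_n$ is an ordered list $[e_1,\ldots,e_m]$ of $m$ pairwise vertex-disjoint edges; $\mathcal{M}_m(K_n)$ is the set of all of these, and $|\mathcal{M}_m(K_n)| = \frac{n!}{2^m}$. A universal cycle of $\mathcal{M}_m(K_n)$ is a cyclic sequence of edges of length $|\mathcal{M}_m(K_n)|$ in which every ordered matching in $\mathcal{M}_m(K_n)$ occurs exactly once as $m$ cyclically consecutive terms. A $2$-by-$\frac{n!}{2}$ shorthand universal torus for the permutations of $[n]=\{0,\ldots,n-1\}$ with $2$-by-$m$ windows is an array $T:\mathbb{Z}_2\times\mathbb{Z}_{n!/2}\to[n]$ such that every word of length $n-1=2m$ with pairwise distinct entries in $[n]$ equals the row-major reading $T(i,j)\cdots T(i,j+m-1)\,T(i+1,j)\cdots T(i+1,j+m-1)$ for exactly one position $(i,j)$ (indices modulo $2$ and $n!/2$). Generating the torus means outputting its columns one after another from left to right. Amortized $\mathcal{O}(1)$-time per column means the total running time is $\mathcal{O}(1)$ times the number $\frac{n!}{2}$ of columns, in the unit-cost RAM model. The universal cycle is given as input; additional space means working space excluding the storage of the input and output. *)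

theory Defs
  imports Main "HOL-Library.Log_Nat" "HOL-Computational_Algebra.Polynomial"
begin

definition complete_edges :: "nat \<Rightarrow> nat set set" where
  "complete_edges n = {e. e \<subseteq> {0..<n} \<and> card e = 2}"

definition ordered_matchings :: "nat \<Rightarrow> nat \<Rightarrow> nat set list set" where
  "ordered_matchings m n =
     {M. length M = m \<and> set M \<subseteq> complete_edges n \<and> sorted_wrt disjnt M}"

definition cyclic_factor :: "'a list \<Rightarrow> nat \<Rightarrow> nat \<Rightarrow> 'a list" where
  "cyclic_factor U m i = map (\<lambda>k. U ! ((i + k) mod length U)) [0..<m]"

definition universal_cycle :: "nat \<Rightarrow> nat \<Rightarrow> nat set list \<Rightarrow> bool" where
  "universal_cycle m n U \<longleftrightarrow>
     set U \<subseteq> complete_edges n \<and>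
     length U = card (ordered_matchings m n) \<and>
     (\<forall>M \<in> ordered_matchings m n. \<exists>!i. i < length U \<and> cyclic_factor U m i = M)"

text \<open>Row indices are taken modulo 2 and column indices modulo \<open>fact n div 2\<close>; the values of
  \<open>T\<close> outside these ranges are irrelevant.\<close>

definition window_reading :: "nat \<Rightarrow> nat \<Rightarrow> (nat \<Rightarrow> nat \<Rightarrow> nat) \<Rightarrow> nat \<Rightarrow> nat \<Rightarrow> nat list" where
  "window_reading m n T i j =
     map (\<lambda>k. T i ((j + k) mod (fact n div 2))) [0..<m] @
     map (\<lambda>k. T ((i + 1) mod 2) ((j + k) mod (fact n div 2))) [0..<m]"

definition shorthand_universal_torus :: "nat \<Rightarrow> nat \<Rightarrow> (nat \<Rightarrow> nat \<Rightarrow> nat) \<Rightarrow> bool" where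
  "shorthand_universal_torus m n T \<longleftrightarrow>
     (\<forall>i < 2. \<forall>j < fact n div 2. T i j < n) \<and>
     (\<forall>w. length w = n - 1 \<and> distinct w \<and> set w \<subseteq> {0..<n} \<longrightarrow>
        (\<exists>!(i, j). i < 2 \<and> j < fact n div 2 \<and> window_reading m n T i j = w))"

definition torus_columns :: "nat \<Rightarrow> (nat \<Rightarrow> nat \<Rightarrow> nat) \<Rightarrow> (nat \<times> nat) list" where
  "torus_columns n T = map (\<lambda>j. (T 0 j, T 1 j)) [0..<fact n div 2]"

text \<open>A random access machine over natural numbers with addition and truncated subtraction as its
  only arithmetic. Input is a read-only array with random access, output is a write-only stream;
  neither is part of the working memory.\<close>

datatype instr =
    Const nat nat
  | Move nat nat
  | Add nat nat nat
  | Sub nat nat nat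
  | Load nat nat
  | Store nat nat
  | Read nat nat
  | Write nat
  | Jump nat
  | JumpZero nat nat

type_synonym program = "instr list"

record config =
  pc :: nat
  regs :: "nat \<Rightarrow> nat"
  written :: "nat list"

fun exec :: "nat list \<Rightarrow> instr \<Rightarrow> config \<Rightarrow> config" where
  "exec x (Const a k) c = c\<lparr>pc := pc c + 1, regs := (regs c)(a := k)\<rparr>"
| "exec x (Move a b) c = c\<lparr>pc := pc c + 1, regs := (regs c)(a := regs c b)\<rparr>"
| "exec x (Add a b d) c = c\<lparr>pc := pc c + 1, regs := (regs c)(a := regs c b + regs c d)\<rparr>"
| "exec x (Sub a b d) c = c\<lparr>pc := pc c + 1, regs := (regs c)(a := regs c b - regs c d)\<rparr>"
| "exec x (Load a b) c = c\<lparr>pc := pc c + 1, regs := (regs c)(a := regs c (regs c b))\<rparr>"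
| "exec x (Store a b) c = c\<lparr>pc := pc c + 1, regs := (regs c)(regs c a := regs c b)\<rparr>"
| "exec x (Read a b) c =
     c\<lparr>pc := pc c + 1,
       regs := (regs c)(a := (if regs c b < length x then x ! regs c b else 0))\<rparr>"
| "exec x (Write a) c = c\<lparr>pc := pc c + 1, written := written c @ [regs c a]\<rparr>"
| "exec x (Jump l) c = c\<lparr>pc := l\<rparr>"
| "exec x (JumpZero a l) c = c\<lparr>pc := (if regs c a = 0 then l else pc c + 1)\<rparr>"

definition halted :: "program \<Rightarrow> config \<Rightarrow> bool" where
  "halted P c \<longleftrightarrow> length P \<le> pc c"

definition step :: "program \<Rightarrow> nat list \<Rightarrow> config \<Rightarrow> config" where
  "step P x c = (if halted P c then c else exec x (P ! pc c) c)"

definition initial :: config where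
  "initial = \<lparr>pc = 0, regs = (\<lambda>_. 0), written = []\<rparr>"

definition config_at :: "program \<Rightarrow> nat list \<Rightarrow> nat \<Rightarrow> config" where
  "config_at P x t = (step P x ^^ t) initial"

text \<open>Space is counted in bits: each register with nonzero content is charged the binary length
  (\<open>floorlog 2\<close>) of its address and of its content, so neither huge numbers nor scattered addresses
  come for free. All registers start at 0 and each step changes at most one of them, so the sum is
  finite at every configuration of a run.\<close>

definition space_used :: "config \<Rightarrow> nat" where
  "space_used c = (\<Sum>a | regs c a \<noteq> 0. floorlog 2 a + floorlog 2 (regs c a))"

definition outputs_within :: "program \<Rightarrow> nat list \<Rightarrow> nat list \<Rightarrow> nat \<Rightarrow> nat \<Rightarrow> bool" where
  "outputs_within P x y time space \<longleftrightarrow>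
     (\<exists>t \<le> time. halted P (config_at P x t) \<and> written (config_at P x t) = y \<and>
        (\<forall>s \<le> t. space_used (config_at P x s) \<le> space))"

definition flatten_pairs :: "(nat \<times> nat) list \<Rightarrow> nat list" where
  "flatten_pairs ps = concat (map (\<lambda>(a, b). [a, b]) ps)"

text \<open>An edge is presented to the machine by its two endpoints, in either order.\<close>

definition edges_of :: "(nat \<times> nat) list \<Rightarrow> nat set list" where
  "edges_of E = map (\<lambda>(a, b). {a, b}) E"

definition encode_input :: "nat \<Rightarrow> (nat \<times> nat) list \<Rightarrow> nat list" where
  "encode_input n E = n # length E # flatten_pairs E"

end

theory Submission
  imports Defs "HOL-Number_Theory.Cong"
begin

text \<open>
  Let \<open>N\<close> be the length of the universal cycle; comparing the words with the oriented ordered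
  matchings gives \<open>N * 2 ^ m = fact n\<close>, so the torus consists of \<open>2 ^ (m - 1)\<close> copies of the cycle
  with suitably oriented edges, and \<open>m\<close> divides \<open>N\<close>. In copy \<open>B\<close> the edge at position \<open>r\<close> is
  flipped according to bit \<open>r mod m\<close> of \<open>B + 1\<close>, except that positions with \<open>r mod m = m - 1\<close> are
  never flipped. A window meets every residue class modulo \<open>m\<close> once. Its underlying matching
  determines its phase \<open>r\<close>, its never-flipped edge determines its top row, and the remaining
  flips determine \<open>B\<close> modulo \<open>2 ^ (m - 1)\<close> bit by bit, lowest bit first, also if the window runs
  over into copy \<open>B + 1\<close>. A machine produces the columns while incrementing the counter
  during its pass through the first \<open>m\<close> columns of each copy, so every column costs \<open>O(1)\<close> steps.
\<close>

section \<open>Counting ordered matchings\<close>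

lemma edges_of_Cons: "edges_of ((a, b) # ps) = {a, b} # edges_of ps"
  and edges_of_Nil: "edges_of [] = []"
  and length_edges_of: "length (edges_of ps) = length ps"
  and set_edges_of: "set (edges_of ps) = (\<lambda>(a, b). {a, b}) ` set ps"
  by (simp_all add: edges_of_def)

text \<open>Reading all first endpoints and then all second endpoints turns an oriented ordered
  matching into a word; disjointness of the edges becomes distinctness of its letters. This is the
  link between matchings and torus windows.\<close>

lemma edges_of_in_ordered_matchings_iff:
  "edges_of ps \<in> ordered_matchings m n \<longleftrightarrow>
     length ps = m \<and> distinct (map fst ps @ map snd ps) \<and> set (map fst ps @ map snd ps) \<subseteq> {0..<n}"
proof (induction ps arbitrary: m)
  case Nil
  then show ?case by (auto simp: ordered_matchings_def edges_of_Nil)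
next
  case (Cons p ps)
  obtain a b where p: "p = (a, b)" by fastforce
  have "edges_of (p # ps) \<in> ordered_matchings m n \<longleftrightarrow>
      m = Suc (length ps) \<and> edges_of ps \<in> ordered_matchings (length ps) n \<and>
      {a, b} \<in> complete_edges n \<and> (\<forall>e \<in> set (edges_of ps). disjnt {a, b} e)"
    by (auto simp: ordered_matchings_def p edges_of_Cons length_edges_of)
  also have "{a, b} \<in> complete_edges n \<longleftrightarrow> a \<noteq> b \<and> a < n \<and> b < n"
    by (auto simp: complete_edges_def card_insert_if)
  also have "(\<forall>e \<in> set (edges_of ps). disjnt {a, b} e) \<longleftrightarrow>
      a \<notin> fst ` set ps \<and> a \<notin> snd ` set ps \<and> b \<notin> fst ` set ps \<and> b \<notin> snd ` set ps"
    by (auto simp: set_edges_of disjnt_def fst_eq_Domain snd_eq_Range)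
  finally show ?case
    using Cons.IH[of "length ps"] by (auto simp: p)
qed

text \<open>Each 2-element edge has exactly two orientations, chosen independently along the list,
  so a fiber is a product of pairs.\<close>

lemma finite_edges_of_fiber: "finite {ps. edges_of ps = M}"
  and card_edges_of_fiber: "(\<forall>e \<in> set M. card e = 2) \<Longrightarrow> card {ps. edges_of ps = M} = 2 ^ length M"
proof -
  have "finite {ps. edges_of ps = M} \<and>
      ((\<forall>e \<in> set M. card e = 2) \<longrightarrow> card {ps. edges_of ps = M} = 2 ^ length M)"
  proof (induction M)
    case Nil
    then show ?case by (simp add: edges_of_def)
  next
    case (Cons e M)
    let ?O = "{(a, b). {a, b} = e}"
    have fiber: "{ps. edges_of ps = e # M} = (\<lambda>(p, ps). p # ps) ` (?O \<times> {ps. edges_of ps = M})"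
    proof (rule set_eqI)
      fix qs
      show "qs \<in> {ps. edges_of ps = e # M} \<longleftrightarrow>
          qs \<in> (\<lambda>(p, ps). p # ps) ` (?O \<times> {ps. edges_of ps = M})"
        by (cases qs) (auto simp: edges_of_def)
    qed
    have inj: "inj_on (\<lambda>(p, ps). p # ps) (?O \<times> {ps. edges_of ps = M})"
      by (auto simp: inj_on_def)
    have fin: "finite ?O"
    proof (cases "finite e")
      case True
      have "?O \<subseteq> e \<times> e" by auto
      then show ?thesis using True finite_subset by blast
    next
      case False
      then have "?O = {}" by auto
      then show ?thesis by simp
    qed
    have "card ?O = 2" if e: "card e = 2"
    proof -
      obtain u v where uv: "e = {u, v}" "u \<noteq> v" using e unfolding card_2_iff by blast
      then have "?O = {(u, v), (v, u)}" by (auto simp: doubleton_eq_iff)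
      then show ?thesis using uv by simp
    qed
    then show ?case
      using Cons.IH fin unfolding fiber by (simp add: card_image[OF inj] card_cartesian_product)
  qed
  then show "finite {ps. edges_of ps = M}"
    and "(\<forall>e \<in> set M. card e = 2) \<Longrightarrow> card {ps. edges_of ps = M} = 2 ^ length M"
    by auto
qed

lemma finite_ordered_matchings: "finite (ordered_matchings m n)"
proof (rule finite_subset)
  show "ordered_matchings m n \<subseteq> {M. set M \<subseteq> Pow {0..<n} \<and> length M = m}"
    by (auto simp: ordered_matchings_def complete_edges_def)
qed (simp add: finite_lists_length_eq)

definition shorthand_words :: "nat \<Rightarrow> nat list set" where
  "shorthand_words n = {w. length w = n - 1 \<and> distinct w \<and> set w \<subseteq> {0..<n}}"

text \<open>The last letter of a permutation is determined by the others, so omitting it loses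
  nothing; in the product this is the missing factor 1.\<close>

lemma card_shorthand_words: "card (shorthand_words n) = fact n"
proof -
  have "card (shorthand_words n) = \<Prod>{n - (n - 1) + 1..n}"
    unfolding shorthand_words_def using card_lists_distinct_length_eq[of "{0..<n}" "n - 1"] by simp
  also have "\<dots> = fact n"
  proof (cases n)
    case (Suc k)
    have "\<Prod>{1..Suc k} = \<Prod>{2..Suc k}"
      by (simp add: prod.atLeast_Suc_atMost numeral_2_eq_2)
    then show ?thesis by (simp add: Suc fact_prod numeral_2_eq_2)
  qed simp
  finally show ?thesis .
qed

text \<open>Double counting of oriented ordered matchings: they correspond to the words, and each
  matching carries \<open>2 ^ m\<close> orientations.\<close>

lemma card_ordered_matchings:
  assumes "n = 2 * m + 1"
  shows "card (ordered_matchings m n) * 2 ^ m = fact n"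
proof -
  let ?P = "{ps. edges_of ps \<in> ordered_matchings m n}"
  let ?word = "\<lambda>ps. map fst ps @ map snd ps :: nat list"
  have "bij_betw ?word ?P (shorthand_words n)"
    unfolding bij_betw_def
  proof
    show "inj_on ?word ?P"
      by (auto simp: inj_on_def edges_of_in_ordered_matchings_iff pair_list_eqI)
    show "?word ` ?P = shorthand_words n"
    proof
      show "?word ` ?P \<subseteq> shorthand_words n"
        using assms by (force simp: shorthand_words_def edges_of_in_ordered_matchings_iff)
      show "shorthand_words n \<subseteq> ?word ` ?P"
      proof
        fix w assume w: "w \<in> shorthand_words n"
        \<comment> \<open>The preimage pairs the first half of the word with the second
          half.\<close>
        then have "w = ?word (zip (take m w) (drop m w))"
          using assms by (simp add: shorthand_words_def map_fst_zip map_snd_zip)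
        moreover from this have "zip (take m w) (drop m w) \<in> ?P"
          using w assms unfolding mem_Collect_eq edges_of_in_ordered_matchings_iff
          by (auto simp: shorthand_words_def)
        ultimately show "w \<in> ?word ` ?P" by blast
      qed
    qed
  qed
  then have "fact n = card ?P"
    by (simp add: bij_betw_same_card card_shorthand_words)
  also have "?P = (\<Union>M \<in> ordered_matchings m n. {ps. edges_of ps = M})"
    by auto
  also have "card \<dots> = (\<Sum>M \<in> ordered_matchings m n. card {ps. edges_of ps = M})"
    by (rule card_UN_disjoint) (auto simp: finite_ordered_matchings finite_edges_of_fiber)
  also have "\<dots> = (\<Sum>M \<in> ordered_matchings m n. 2 ^ m)"
    by (intro sum.cong)
      (auto simp: ordered_matchings_def complete_edges_def subset_eq card_edges_of_fiber)
  finally show ?thesis by simp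
qed

text \<open>The even factors of the factorial multiply to \<open>2 ^ m * fact m\<close>, and
  \<open>d\<close> collects the odd ones.\<close>

lemma fact_odd_split: "\<exists>d. fact (2 * m + 1) = 2 ^ m * fact m * (d :: nat)"
proof (induction m)
  case (Suc m)
  then obtain d where "fact (2 * m + 1) = 2 ^ m * fact m * (d :: nat)" by blast
  moreover have "2 * Suc m + 1 = Suc (Suc (2 * m + 1))" by simp
  ultimately have "fact (2 * Suc m + 1) = 2 ^ Suc m * fact (Suc m) * ((2 * m + 3) * d)"
    by (simp only: fact_Suc) (simp add: algebra_simps)
  then show ?case by blast
qed auto

text \<open>Cancelling \<open>2 ^ m\<close> leaves a multiple of \<open>fact m\<close>. The
  divisibility keeps residues modulo \<open>m\<close> consistent where the cycle closes up.\<close>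

lemma dvd_card_ordered_matchings:
  assumes "n = 2 * m + 1" and "m \<ge> 1"
  shows "m dvd card (ordered_matchings m n)"
proof -
  obtain d where "fact n = 2 ^ m * fact m * (d :: nat)"
    using fact_odd_split assms(1) by blast
  then have "card (ordered_matchings m n) = fact m * d"
    using card_ordered_matchings[OF assms(1)] by simp
  moreover have "m dvd fact m"
    using assms(2) by (simp add: dvd_fact)
  ultimately show ?thesis by simp
qed

text \<open>There are as many positions as matchings, so the map from positions to factors, which
  hits every matching, is a bijection: every factor is itself a matching.\<close>

lemma universal_cycle_factor:
  assumes "universal_cycle m n U"
  shows "i < length U \<Longrightarrow> cyclic_factor U m i \<in> ordered_matchings m n"
    and "inj_on (cyclic_factor U m) {..<length U}"
proof -
  let ?M = "ordered_matchings m n" and ?I = "{..<length U}"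
  have ex: "\<forall>M \<in> ?M. \<exists>!i. i < length U \<and> cyclic_factor U m i = M"
    using assms unfolding universal_cycle_def by blast
  have len: "card ?I = card ?M"
    using assms by (simp add: universal_cycle_def)
  have sub: "?M \<subseteq> cyclic_factor U m ` ?I"
  proof
    fix M assume "M \<in> ?M"
    then obtain i where "i < length U" "cyclic_factor U m i = M" using ex by blast
    then show "M \<in> cyclic_factor U m ` ?I" by blast
  qed
  then have "card ?M \<le> card (cyclic_factor U m ` ?I)"
    by (simp add: card_mono)
  then have c: "card (cyclic_factor U m ` ?I) = card ?I"
    using card_image_le[of ?I "cyclic_factor U m"] len by simp
  then show "inj_on (cyclic_factor U m) ?I"
    by (simp add: eq_card_imp_inj_on)
  have "?M = cyclic_factor U m ` ?I"
    using sub c len by (simp add: card_subset_eq)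
  then show "i < length U \<Longrightarrow> cyclic_factor U m i \<in> ?M" by blast
qed


section \<open>The torus\<close>

text \<open>\<open>j div N\<close> is the copy and \<open>j mod N\<close> the position in it. The
  successor reflects a counter that is incremented during the copy itself.\<close>

definition swapped :: "nat \<Rightarrow> nat \<Rightarrow> nat \<Rightarrow> bool" where
  "swapped m N j \<longleftrightarrow> j mod N mod m < m - 1 \<and> odd (Suc (j div N) div 2 ^ (j mod N mod m))"

definition torus_of :: "nat \<Rightarrow> (nat \<times> nat) list \<Rightarrow> nat \<Rightarrow> nat \<Rightarrow> nat" where
  "torus_of m E i j =
     (if (i = 0) = swapped m (length E) j then snd else fst) (E ! (j mod length E))"

lemma mod_two_power_Suc_cong:
  fixes x y :: nat
  assumes "[x = y] (mod 2 ^ q)" and "odd (x div 2 ^ q) \<longleftrightarrow> odd (y div 2 ^ q)"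
  shows "[x = y] (mod 2 ^ Suc q)"
proof -
  have "x div 2 ^ q mod 2 = y div 2 ^ q mod 2"
    using assms(2) by (metis even_iff_mod_2_eq_zero odd_iff_mod_2_eq_one)
  then show ?thesis
    using assms(1) by (simp add: cong_def mult.commute[of 2] mod_mult2_eq)
qed

text \<open>Only bits below \<open>m - 1\<close> of the successor matter, and these depend on the
  copy index modulo \<open>2 ^ (m - 1)\<close> alone.\<close>

lemma swapped_wrap:
  assumes "N > 0"
  shows "swapped m N (j mod (2 ^ (m - 1) * N)) = swapped m N j"
proof -
  let ?K = "2 ^ (m - 1) :: nat" and ?j = "j mod (2 ^ (m - 1) * N)"
  let ?q = "j mod N mod m"
  have r: "?j mod N = j mod N" by (simp add: mod_mod_cancel)
  have B: "?j div N = j div N mod ?K"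
    using assms by (simp add: mult.commute[of _ N] mod_mult2_eq)
  have "odd (Suc (j div N mod ?K) div 2 ^ ?q) = odd (Suc (j div N) div 2 ^ ?q)" if "?q < m - 1"
  proof -
    have "(2::nat) ^ Suc ?q dvd ?K"
      using that by (intro le_imp_power_dvd) simp
    then have "Suc (j div N mod ?K) mod 2 ^ Suc ?q = Suc (j div N) mod 2 ^ Suc ?q"
      by (metis mod_Suc_eq mod_mod_cancel)
    then have "bit (Suc (j div N mod ?K)) ?q = bit (Suc (j div N)) ?q"
      by (metis bit_take_bit_iff lessI take_bit_eq_mod)
    then show ?thesis by (simp add: bit_iff_odd)
  qed
  then show ?thesis
    unfolding swapped_def r B by blast
qed

section \<open>Windows of the torus and their decoding\<close>

locale matching_cycle =
  fixes m n :: nat and E :: "(nat \<times> nat) list"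
  assumes m: "m \<ge> 1" and n: "n = 2 * m + 1" and cycle: "universal_cycle m n (edges_of E)"
begin

abbreviation N where "N \<equiv> length E"

lemma N_eq: "N * 2 ^ m = fact n" and m_dvd_N: "m dvd N"
  using cycle card_ordered_matchings[OF n] dvd_card_ordered_matchings[OF n m]
  by (simp_all add: universal_cycle_def length_edges_of)

lemma N_pos: "N > 0"
  using N_eq by (metis fact_nonzero gr0I mult_0)

lemma m_le_N: "m \<le> N"
  using m_dvd_N N_pos by (rule dvd_imp_le)

lemma width: "fact n div 2 = 2 ^ (m - 1) * N"
proof -
  have "(2::nat) ^ m = 2 * 2 ^ (m - 1)" using m by (cases m) auto
  then show ?thesis using N_eq[symmetric] by simp
qed

lemma E_edge:
  assumes "r < N"
  shows "fst (E ! r) \<noteq> snd (E ! r)" and "fst (E ! r) < n" and "snd (E ! r) < n"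
proof -
  obtain a b where ab: "E ! r = (a, b)" by fastforce
  have "edges_of E ! r \<in> complete_edges n"
    using cycle assms nth_mem[of r "edges_of E"]
    by (auto simp: universal_cycle_def length_edges_of)
  then have "{a, b} \<in> complete_edges n"
    using assms ab by (simp add: edges_of_def)
  then show "fst (E ! r) \<noteq> snd (E ! r)" and "fst (E ! r) < n" and "snd (E ! r) < n"
    by (auto simp: ab complete_edges_def card_insert_if split: if_splits)
qed

abbreviation T where "T \<equiv> torus_of m E"

lemma T_wrap: "T i (j mod (fact n div 2)) = T i j"
  unfolding torus_of_def width using swapped_wrap[OF N_pos] by (simp add: mod_mod_cancel)

text \<open>The window taken column by column with row \<open>i\<close> first; column indices stay
  unreduced, which \<open>T_wrap\<close> justifies.\<close>

definition window_pairs :: "nat \<Rightarrow> nat \<Rightarrow> (nat \<times> nat) list" where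
  "window_pairs i j = map (\<lambda>k. (T i (j + k), T ((i + 1) mod 2) (j + k))) [0..<m]"

lemma window_reading_eq:
  "window_reading m n T i j = map fst (window_pairs i j) @ map snd (window_pairs i j)"
  by (simp add: window_reading_def window_pairs_def T_wrap comp_def)

lemma edges_of_window:
  assumes "i < 2"
  shows "edges_of (window_pairs i j) = cyclic_factor (edges_of E) m (j mod N)"
proof -
  have "{T i k, T ((i + 1) mod 2) k} = edges_of E ! (k mod N)" for k
  proof -
    obtain a b where "E ! (k mod N) = (a, b)" by fastforce
    moreover have "i = 0 \<or> i = 1" using assms by auto
    ultimately show ?thesis
      using N_pos by (auto simp: torus_of_def edges_of_def)
  qed
  moreover have "edges_of (window_pairs i j) =
      map (\<lambda>k. {T i (j + k), T ((i + 1) mod 2) (j + k)}) [0..<m]"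
    by (simp add: edges_of_def window_pairs_def)
  ultimately show ?thesis
    by (simp add: cyclic_factor_def length_edges_of mod_add_left_eq)
qed

lemma window_in_words:
  assumes "i < 2"
  shows "window_reading m n T i j \<in> shorthand_words n"
proof -
  have "edges_of (window_pairs i j) \<in> ordered_matchings m n"
    unfolding edges_of_window[OF assms]
    using universal_cycle_factor(1)[OF cycle] N_pos by (simp add: length_edges_of)
  then show ?thesis
    unfolding edges_of_in_ordered_matchings_iff shorthand_words_def window_reading_eq
    using n by simp
qed

lemma window_inj:
  assumes i: "i < 2" "i' < 2" and j: "j < fact n div 2" "j' < fact n div 2"
    and eq: "window_reading m n T i j = window_reading m n T i' j'"
  shows "i = i' \<and> j = j'"
proof -
  let ?r = "j mod N"
  have "map fst (window_pairs i j) = map fst (window_pairs i' j')"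
    and "map snd (window_pairs i j) = map snd (window_pairs i' j')"
    using eq unfolding window_reading_eq by (simp_all add: window_pairs_def)
  then have pairs: "window_pairs i j = window_pairs i' j'"
    by (simp add: pair_list_eqI)
  then have "cyclic_factor (edges_of E) m ?r = cyclic_factor (edges_of E) m (j' mod N)"
    using edges_of_window i by metis
  then have r: "j' mod N = ?r"
    using universal_cycle_factor(2)[OF cycle] N_pos
    by (simp add: inj_on_def length_edges_of)
  have r': "(j' + t) mod N = (j + t) mod N" for t
    using r by (metis mod_add_left_eq)
  \<comment> \<open>The endpoints of an edge differ, so equal entries force equal
    orientations.\<close>
  have key: "(i = 0) = swapped m N (j + t) \<longleftrightarrow> (i' = 0) = swapped m N (j' + t)" if "t < m" for t
  proof -
    have "T i (j + t) = T i' (j' + t)"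
      using pairs that by (simp add: window_pairs_def)
    then show ?thesis
      using E_edge(1)[of "(j + t) mod N"] N_pos
      by (simp add: torus_of_def r' split: if_splits)
  qed
  have phase: "\<exists>t < m. (j + t) mod N mod m = q" if "q < m" for q
  proof -
    \<comment> \<open>The distance from \<open>j\<close> to the next position of residue
      \<open>q\<close> modulo \<open>m\<close>.\<close>
    define t where "t = (q + (m - j mod m)) mod m"
    have "(j + t) mod m = (j mod m + (q + (m - j mod m))) mod m"
      unfolding t_def by (simp add: mod_simps)
    also have "j mod m + (q + (m - j mod m)) = q + m"
      using mod_less_divisor[of m j] m by linarith
    finally have "(j + t) mod m = q" using that by simp
    moreover have "(j + t) mod N mod m = (j + t) mod m"
      using m_dvd_N by (rule mod_mod_cancel)
    moreover have "t < m" using m by (simp add: t_def)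
    ultimately show ?thesis by auto
  qed
  \<comment> \<open>The column of residue \<open>m - 1\<close> is never swapped, so it reveals the
    row.\<close>
  obtain t where "t < m" "(j + t) mod N mod m = m - 1"
    using phase[of "m - 1"] m by auto
  then have "i = 0 \<longleftrightarrow> i' = 0"
    using key[of t] by (auto simp: swapped_def r')
  then have ii: "i = i'" using i by auto
  \<comment> \<open>\<open>e t\<close> counts the copy boundaries crossed after \<open>t\<close>
    columns; it depends only on the phase, hence is the same for both windows.\<close>
  define e where "e t = (?r + t) div N" for t
  have div: "(a + t) div N = a div N + (a mod N + t) div N" for a t
  proof -
    have "a + t = (a mod N + t) + a div N * N"
      by (simp add: algebra_simps)
    then show ?thesis using N_pos by (metis div_mult_self1 less_not_refl)
  qed
  have block: "(j + t) div N = j div N + e t" "(j' + t) div N = j' div N + e t" for t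
    unfolding e_def using div[of j t] div[of j' t] r by simp_all
  \<comment> \<open>The column of residue \<open>q\<close> shows bit \<open>q\<close> of the copy
    index plus \<open>Suc (e t)\<close>. The lower bits agree by induction, so one more bit agrees,
    and the common shift cancels.\<close>
  have "[j div N = j' div N] (mod 2 ^ q)" if "q \<le> m - 1" for q
    using that
  proof (induction q)
    case 0
    then show ?case by simp
  next
    case (Suc q)
    then have "q < m" by linarith
    then obtain t where t: "t < m" "(j + t) mod N mod m = q"
      using phase by blast
    let ?x = "Suc (j div N + e t)" and ?y = "Suc (j' div N + e t)"
    have "swapped m N (j + t) = swapped m N (j' + t)"
      using key[OF t(1)] ii by (cases "i' = 0") simp_all
    then have "odd (?x div 2 ^ q) \<longleftrightarrow> odd (?y div 2 ^ q)"
      using t(2) Suc.prems by (simp add: swapped_def r' block Suc_le_eq)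
    moreover have "[?x = ?y] (mod 2 ^ q)"
      using Suc by (simp only: Suc_eq_plus1 cong_add_rcancel_nat)
    ultimately have "[?x = ?y] (mod 2 ^ Suc q)"
      by (intro mod_two_power_Suc_cong)
    then show ?case
      by (simp only: Suc_eq_plus1 cong_add_rcancel_nat)
  qed
  then have "[j div N = j' div N] (mod 2 ^ (m - 1))" by simp
  moreover have "j div N < 2 ^ (m - 1)" "j' div N < 2 ^ (m - 1)"
    using j N_pos unfolding width by (simp_all add: less_mult_imp_div_less)
  ultimately have "j div N = j' div N"
    by (simp add: cong_def)
  then have "j = j'"
    using r by (metis div_mult_mod_eq)
  then show ?thesis using ii by simp
qed

text \<open>There are \<open>fact n\<close> positions and \<open>fact n\<close> words, so
  injectivity of the reading already makes it onto.\<close>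

lemma torus_of_universal: "shorthand_universal_torus m n T"
  unfolding shorthand_universal_torus_def
proof (intro conjI allI impI)
  fix i j
  show "T i j < n"
    using E_edge[of "j mod N"] N_pos by (simp add: torus_of_def)
next
  fix w assume "length w = n - 1 \<and> distinct w \<and> set w \<subseteq> {0..<n}"
  then have w: "w \<in> shorthand_words n" by (simp add: shorthand_words_def)
  let ?I = "{..<2::nat} \<times> {..<fact n div 2 :: nat}"
  let ?read = "\<lambda>(i, j). window_reading m n T i j"
  have inj: "inj_on ?read ?I"
    using window_inj by (auto simp: inj_on_def)
  \<comment> \<open>Evenness makes twice \<open>fact n div 2\<close> equal to
    \<open>fact n\<close>.\<close>
  have "even (fact n :: nat)" using m n by (intro dvd_fact) auto
  then have "card ?I = card (shorthand_words n)"
    by (simp add: card_shorthand_words)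
  moreover have "finite (shorthand_words n)"
    using card_shorthand_words[of n] by (metis card.infinite fact_nonzero)
  moreover have "?read ` ?I \<subseteq> shorthand_words n"
    using window_in_words by auto
  ultimately have "?read ` ?I = shorthand_words n"
    by (simp add: card_subset_eq card_image[OF inj])
  then obtain p where "p \<in> ?I" "?read p = w"
    using w by (metis (no_types, lifting) imageE)
  then show "\<exists>!(i, j). i < 2 \<and> j < fact n div 2 \<and> window_reading m n T i j = w"
    using inj by (intro ex1I[of _ p]) (auto simp: inj_on_def)
qed

end


section \<open>The machine\<close>

definition reg :: "nat \<Rightarrow> nat" where
  "reg i = 2 * i + 1"

text \<open>Registers sit at the odd addresses: 0 and 1 hold the constants 1 and 2, 2 holds \<open>2 * m\<close>, 3 the
  length of the cycle, 4 the current cell address, 5 the input position, 6 the number of columns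
  left in the copy, 7 the carry, 8 the current bit, 9 and 10 the edge. Counter bit \<open>q\<close> is the cell
  at the even address \<open>2 * m - 2 * q\<close>. Register 9 is still 0 when it serves as the input index of
  \<open>n\<close>, and address 2 is bit \<open>m - 1\<close>, which becomes 1 exactly in the last copy.\<close>

definition torus_program :: program where
  "torus_program =
    [Const (reg 0) 1,
     Const (reg 1) 2,
     Read (reg 2) (reg 9),
     Sub (reg 2) (reg 2) (reg 0),
     Read (reg 3) (reg 0),
     Move (reg 4) (reg 2),
     Const (reg 5) 2,
     Move (reg 6) (reg 3),
     Const (reg 7) 1,
     Load (reg 8) (reg 4),
     JumpZero (reg 7) 14,
     Sub (reg 8) (reg 0) (reg 8),
     Store (reg 4) (reg 8),
     Sub (reg 7) (reg 0) (reg 8),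
     Sub (reg 4) (reg 4) (reg 1),
     JumpZero (reg 4) 17,
     Jump 19,
     Move (reg 4) (reg 2),
     Const (reg 8) 0,
     Read (reg 9) (reg 5),
     Add (reg 5) (reg 5) (reg 0),
     Read (reg 10) (reg 5),
     Add (reg 5) (reg 5) (reg 0),
     JumpZero (reg 8) 27,
     Write (reg 10),
     Write (reg 9),
     Jump 29,
     Write (reg 9),
     Write (reg 10),
     Sub (reg 6) (reg 6) (reg 0),
     JumpZero (reg 6) 32,
     Jump 9,
     JumpZero 2 6]"

section \<open>Symbolic execution of the program and its space\<close>

lemma length_torus_program: "length torus_program = 33"
  by (simp add: torus_program_def)

lemma torus_program_at:
  "torus_program ! 0 = Const (reg 0) 1"
  "torus_program ! Suc 0 = Const (reg 1) 2"
  "torus_program ! 2 = Read (reg 2) (reg 9)"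
  "torus_program ! 3 = Sub (reg 2) (reg 2) (reg 0)"
  "torus_program ! 4 = Read (reg 3) (reg 0)"
  "torus_program ! 5 = Move (reg 4) (reg 2)"
  "torus_program ! 6 = Const (reg 5) 2"
  "torus_program ! 7 = Move (reg 6) (reg 3)"
  "torus_program ! 8 = Const (reg 7) 1"
  "torus_program ! 9 = Load (reg 8) (reg 4)"
  "torus_program ! 10 = JumpZero (reg 7) 14"
  "torus_program ! 11 = Sub (reg 8) (reg 0) (reg 8)"
  "torus_program ! 12 = Store (reg 4) (reg 8)"
  "torus_program ! 13 = Sub (reg 7) (reg 0) (reg 8)"
  "torus_program ! 14 = Sub (reg 4) (reg 4) (reg 1)"
  "torus_program ! 15 = JumpZero (reg 4) 17"
  "torus_program ! 16 = Jump 19"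
  "torus_program ! 17 = Move (reg 4) (reg 2)"
  "torus_program ! 18 = Const (reg 8) 0"
  "torus_program ! 19 = Read (reg 9) (reg 5)"
  "torus_program ! 20 = Add (reg 5) (reg 5) (reg 0)"
  "torus_program ! 21 = Read (reg 10) (reg 5)"
  "torus_program ! 22 = Add (reg 5) (reg 5) (reg 0)"
  "torus_program ! 23 = JumpZero (reg 8) 27"
  "torus_program ! 24 = Write (reg 10)"
  "torus_program ! 25 = Write (reg 9)"
  "torus_program ! 26 = Jump 29"
  "torus_program ! 27 = Write (reg 9)"
  "torus_program ! 28 = Write (reg 10)"
  "torus_program ! 29 = Sub (reg 6) (reg 6) (reg 0)"
  "torus_program ! 30 = JumpZero (reg 6) 32"
  "torus_program ! 31 = Jump 9"
  "torus_program ! 32 = JumpZero 2 6"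
  by (simp_all add: torus_program_def)

text \<open>Odd addresses hold the fixed list \<open>v\<close> of registers, even addresses the
  counter cells \<open>f\<close>, so the growing counter never collides with a register.\<close>

definition memory :: "nat list \<Rightarrow> (nat \<Rightarrow> nat) \<Rightarrow> nat \<Rightarrow> nat" where
  "memory v f a =
     (if even a then f (a div 2) else if a div 2 < length v then v ! (a div 2) else 0)"

definition machine :: "nat \<Rightarrow> nat list \<Rightarrow> (nat \<Rightarrow> nat) \<Rightarrow> nat list \<Rightarrow> config" where
  "machine k v f w = \<lparr>pc = k, regs = memory v f, written = w\<rparr>"

lemma memory_reg: "i < length v \<Longrightarrow> memory v f (reg i) = v ! i"
  by (simp add: memory_def reg_def)

lemma memory_cell: "memory v f (2 * i) = f i"
  by (simp add: memory_def)

lemma memory_update_reg: "i < length v \<Longrightarrow> (memory v f)(reg i := a) = memory (v[i := a]) f"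
  by (auto simp: memory_def reg_def fun_eq_iff nth_list_update elim!: oddE)

lemma memory_update_cell: "(memory v f)(2 * i := a) = memory v (f(i := a))"
  by (auto simp: memory_def fun_eq_iff)

lemma list_update_Cons_numeral:
  "(x # xs)[numeral k := y] = x # xs[pred_numeral k := y]"
  by (simp add: numeral_eq_Suc)

lemma exec_machine:
  "a < length v \<Longrightarrow> exec x (Const (reg a) d) (machine k v f w) = machine (k + 1) (v[a := d]) f w"
  "a < length v \<Longrightarrow> b < length v \<Longrightarrow>
     exec x (Move (reg a) (reg b)) (machine k v f w) = machine (k + 1) (v[a := v ! b]) f w"
  "a < length v \<Longrightarrow> b < length v \<Longrightarrow> d < length v \<Longrightarrow>
     exec x (Add (reg a) (reg b) (reg d)) (machine k v f w) =
     machine (k + 1) (v[a := v ! b + v ! d]) f w"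
  "a < length v \<Longrightarrow> b < length v \<Longrightarrow> d < length v \<Longrightarrow>
     exec x (Sub (reg a) (reg b) (reg d)) (machine k v f w) =
     machine (k + 1) (v[a := v ! b - v ! d]) f w"
  "a < length v \<Longrightarrow> b < length v \<Longrightarrow> v ! b = 2 * i \<Longrightarrow>
     exec x (Load (reg a) (reg b)) (machine k v f w) = machine (k + 1) (v[a := f i]) f w"
  "a < length v \<Longrightarrow> b < length v \<Longrightarrow> v ! a = 2 * i \<Longrightarrow>
     exec x (Store (reg a) (reg b)) (machine k v f w) = machine (k + 1) v (f(i := v ! b)) w"
  "a < length v \<Longrightarrow> b < length v \<Longrightarrow>
     exec x (Read (reg a) (reg b)) (machine k v f w) =
     machine (k + 1) (v[a := (if v ! b < length x then x ! (v ! b) else 0)]) f w"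
  "a < length v \<Longrightarrow> exec x (Write (reg a)) (machine k v f w) = machine (k + 1) v f (w @ [v ! a])"
  "exec x (Jump l) (machine k v f w) = machine l v f w"
  "a < length v \<Longrightarrow>
     exec x (JumpZero (reg a) l) (machine k v f w) = machine (if v ! a = 0 then l else k + 1) v f w"
  by (simp_all add: machine_def memory_reg memory_cell memory_update_reg memory_update_cell)

lemma exec_machine_cell_1:
  "exec x (JumpZero 2 l) (machine k v f w) = machine (if f 1 = 0 then l else k + 1) v f w"
  by (simp add: machine_def memory_def)

lemma step_machine:
  "k < length P \<Longrightarrow> step P x (machine k v f w) = exec x (P ! k) (machine k v f w)"
  by (simp add: step_def halted_def machine_def)

text \<open>Nonzero contents sit at addresses at most \<open>2 * m + 2 * l\<close>. The crude bound
  \<open>floorlog 2 a \<le> a\<close> for an address is enough for a polynomial.\<close>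

lemma space_machine:
  assumes "length v = l" and "\<forall>a \<in> set v. a \<le> V" and "\<forall>i. f i \<le> V" and "\<forall>i > m. f i = 0"
  shows "space_used (machine k v f w) \<le> (2 * m + 2 * l + 1) * (2 * m + 2 * l + floorlog 2 V)"
proof -
  let ?M = "memory v f" and ?K = "2 * m + 2 * l"
  have bound: "?M a \<le> V" for a
    using assms(2,3) by (simp add: memory_def)
  have supp: "{a. ?M a \<noteq> 0} \<subseteq> {..?K}"
  proof
    fix a assume "a \<in> {a. ?M a \<noteq> 0}"
    then have nz: "?M a \<noteq> 0" by simp
    show "a \<in> {..?K}"
    proof (cases "even a")
      case True
      then have "a div 2 \<le> m" using nz assms(4) by (metis memory_def not_le)
      then show ?thesis using True by auto
    next
      case False
      then have "a div 2 < l" using nz assms(1) by (simp add: memory_def split: if_splits)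
      then show ?thesis by auto
    qed
  qed
  have "space_used (machine k v f w) = (\<Sum>a | ?M a \<noteq> 0. floorlog 2 a + floorlog 2 (?M a))"
    by (simp add: space_used_def machine_def)
  also have "\<dots> \<le> (\<Sum>a \<in> {a. ?M a \<noteq> 0}. ?K + floorlog 2 V)"
  proof (rule sum_mono)
    fix a assume "a \<in> {a. ?M a \<noteq> 0}"
    then have "a \<le> ?K" using supp by blast
    moreover have "floorlog 2 a \<le> a" by (rule floorlog_leI) simp_all
    ultimately show "floorlog 2 a + floorlog 2 (?M a) \<le> ?K + floorlog 2 V"
      using floorlog_mono[OF bound] by (intro add_mono) auto
  qed
  also have "\<dots> \<le> (\<Sum>a \<in> {..?K}. ?K + floorlog 2 V)"
    using supp by (intro sum_mono2) auto
  finally show ?thesis by simp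
qed

text \<open>The space of the final configuration is not counted, so that runs compose.\<close>

definition reaches :: "program \<Rightarrow> nat list \<Rightarrow> nat \<Rightarrow> nat \<Rightarrow> config \<Rightarrow> config \<Rightarrow> bool" where
  "reaches P x s t c c' \<longleftrightarrow>
     (\<exists>u \<le> t. (step P x ^^ u) c = c' \<and> (\<forall>v < u. space_used ((step P x ^^ v) c) \<le> s))"

lemma reaches_refl: "c = c' \<Longrightarrow> reaches P x s t c c'"
  unfolding reaches_def by (rule exI[of _ 0]) simp

lemma reaches_mono: "reaches P x s t c c' \<Longrightarrow> t \<le> t' \<Longrightarrow> reaches P x s t' c c'"
  unfolding reaches_def using le_trans by blast

lemma reaches_step:
  assumes "space_used c \<le> s" and "step P x c = c1" and "t > 0" and "reaches P x s (t - 1) c1 c'"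
  shows "reaches P x s t c c'"
proof -
  obtain u where u: "u \<le> t - 1" "(step P x ^^ u) c1 = c'"
      "\<forall>v < u. space_used ((step P x ^^ v) c1) \<le> s"
    using assms(4) by (auto simp: reaches_def)
  have "space_used ((step P x ^^ v) c) \<le> s" if "v < Suc u" for v
    using that u(3) assms(1,2) by (cases v) (auto simp: funpow_Suc_right simp del: funpow.simps)
  then show ?thesis
    unfolding reaches_def using u assms(2,3)
    by (intro exI[of _ "Suc u"]) (auto simp: funpow_Suc_right simp del: funpow.simps)
qed

lemma reaches_trans:
  assumes "reaches P x s t1 c1 c2" and "reaches P x s t2 c2 c3" and "t1 + t2 \<le> t"
  shows "reaches P x s t c1 c3"
proof -
  obtain u1 where u1: "u1 \<le> t1" "(step P x ^^ u1) c1 = c2"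
      "\<forall>v < u1. space_used ((step P x ^^ v) c1) \<le> s"
    using assms(1) by (auto simp: reaches_def)
  obtain u2 where u2: "u2 \<le> t2" "(step P x ^^ u2) c2 = c3"
      "\<forall>v < u2. space_used ((step P x ^^ v) c2) \<le> s"
    using assms(2) by (auto simp: reaches_def)
  have eq: "(step P x ^^ (v + u1)) c1 = (step P x ^^ v) c2" for v
    by (simp add: funpow_add u1(2))
  have "space_used ((step P x ^^ v) c1) \<le> s" if "v < u1 + u2" for v
  proof (cases "v < u1")
    case False
    then show ?thesis using eq[of "v - u1"] u2(3) that by auto
  qed (use u1(3) in blast)
  moreover have "(step P x ^^ (u1 + u2)) c1 = c3"
    using eq[of u2] u2(2) by (simp add: add.commute)
  ultimately show ?thesis
    unfolding reaches_def using u1(1) u2(1) assms(3) by (intro exI[of _ "u1 + u2"]) auto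
qed

section \<open>Runs of the torus program\<close>

context matching_cycle
begin

abbreviation x where "x \<equiv> encode_input n E"

text \<open>A common bound for all register contents: input positions are at most
  \<open>2 + 2 * N\<close>, cell addresses at most \<open>2 * m\<close>, and vertices less than
  \<open>n\<close>.\<close>

definition V :: nat where "V = 2 * N + 4 * m + 4"

definition space_bound :: nat where
  "space_bound = (2 * m + 2 * 11 + 1) * (2 * m + 2 * 11 + floorlog 2 V)"

definition bit_cells :: "(nat \<Rightarrow> nat) \<Rightarrow> bool" where
  "bit_cells f \<longleftrightarrow> (\<forall>i. f i \<le> 1) \<and> (\<forall>i > m. f i = 0)"

lemma space_ok:
  assumes "length v = 11" and "\<forall>a \<in> set v. a \<le> V" and "bit_cells f"
  shows "space_used (machine k v f w) \<le> space_bound"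
  unfolding space_bound_def
proof (rule space_machine[OF assms(1,2)])
  show "\<forall>i. f i \<le> V"
  proof
    fix i
    have "f i \<le> 1" using assms(3) by (simp add: bit_cells_def)
    then show "f i \<le> V" by (simp add: V_def)
  qed
qed (use assms(3) in \<open>simp add: bit_cells_def\<close>)

abbreviation run where "run \<equiv> reaches torus_program x space_bound"

lemma flatten_pairs_nth:
  "r < length ps \<Longrightarrow> flatten_pairs ps ! (2 * r) = fst (ps ! r)"
  "r < length ps \<Longrightarrow> flatten_pairs ps ! Suc (2 * r) = snd (ps ! r)"
  by (induction ps arbitrary: r) (auto simp: flatten_pairs_def nth_Cons split: nat.splits)

lemma length_flatten_pairs: "length (flatten_pairs ps) = 2 * length ps"
  by (induction ps) (auto simp: flatten_pairs_def)

lemma input_nth: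
  "x ! 0 = n" "x ! Suc 0 = N"
  "r < N \<Longrightarrow> x ! (2 + 2 * r) = fst (E ! r)"
  "r < N \<Longrightarrow> x ! Suc (2 + 2 * r) = snd (E ! r)"
  by (simp_all add: encode_input_def flatten_pairs_nth)

lemma length_input: "length x = 2 + 2 * N"
  by (simp add: encode_input_def length_flatten_pairs)

lemmas run_simps = step_machine length_torus_program torus_program_at exec_machine exec_machine_cell_1
  list_update_Cons_numeral

text \<open>One step of binary increment: a carry flips the bit, and the new carry, the complement
  of the new bit, is the old bit. Without a carry the bit is only loaded.\<close>

lemma run_carry:
  assumes "1 \<le> i" "i \<le> m" "bit_cells f" "cy \<le> 1" "\<forall>a \<in> {p, rem, b, y, z}. a \<le> V"
  shows "run 5 (machine 9 [1, 2, 2 * m, N, 2 * i, p, rem, cy, b, y, z] f w)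
    (machine 14 [1, 2, 2 * m, N, 2 * i, p, rem, if cy = 0 then 0 else 1 - (1 - f i),
        if cy = 0 then f i else 1 - f i, y, z] (if cy = 0 then f else f(i := 1 - f i)) w)"
proof -
  have "f i \<le> 1" "1 - f i \<le> V" "bit_cells (f(i := 1 - f i))"
    using assms by (auto simp: bit_cells_def V_def)
  moreover have "f i \<le> V" "cy \<le> V" "2 * i \<le> V" "2 * m \<le> V" "N \<le> V" "2 \<le> V" "1 \<le> V"
    using \<open>f i \<le> 1\<close> assms n by (auto simp: V_def)
  ultimately show ?thesis
    using assms
    \<comment> \<open>The case split decides the jump; then instructions are executed one by one
      until the target configuration is reached.\<close>
    by (cases "cy = 0")
      (simp_all,
        (rule reaches_refl, simp; fail
         | rule reaches_step, rule space_ok, simp, simp, simp,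
           simp add: run_simps del: exec.simps, simp)+)
qed

text \<open>The cell address moves on to the next higher bit. Past bit \<open>m - 1\<close>, at
  \<open>i = 1\<close>, it returns to bit 0 and the loaded bit is overridden by 0, so this column is
  not swapped.\<close>

lemma run_position:
  assumes "1 \<le> i" "i \<le> m" "bit_cells f" "\<forall>a \<in> {p, rem, cy, b, y, z}. a \<le> V"
  shows "run 5 (machine 14 [1, 2, 2 * m, N, 2 * i, p, rem, cy, b, y, z] f w)
    (machine 19 [1, 2, 2 * m, N, if i = 1 then 2 * m else 2 * (i - 1), p, rem, cy,
        if i = 1 then 0 else b, y, z] f w)"
proof -
  have "2 * i \<le> V" "2 * m \<le> V" "2 * i - 2 \<le> V" "N \<le> V" "2 \<le> V" "1 \<le> V"
    using assms n by (auto simp: V_def)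
  moreover have "(2 * i - 2 = 0) = (i = 1)" "2 * (i - 1) = 2 * i - 2"
    using assms(1) by auto
  ultimately show ?thesis
    using assms
    by (cases "i = 1")
      (simp_all,
        (rule reaches_refl, simp; fail
         | rule reaches_step, rule space_ok, simp, simp, simp,
           simp add: run_simps del: exec.simps, simp)+)
qed

lemma run_output:
  assumes "r < N" "bit_cells f" "\<forall>a \<in> {c, rem, cy, b, y, z}. a \<le> V"
  shows "run 10 (machine 19 [1, 2, 2 * m, N, c, 2 + 2 * r, rem, cy, b, y, z] f w)
    (machine 29 [1, 2, 2 * m, N, c, 2 + 2 * Suc r, rem, cy, b, fst (E ! r), snd (E ! r)] f
      (w @ (if b = 0 then [fst (E ! r), snd (E ! r)] else [snd (E ! r), fst (E ! r)])))"
proof -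
  have "2 + 2 * r < length x" "Suc (2 + 2 * r) < length x"
    using assms(1) by (simp_all add: length_input)
  moreover have "2 + 2 * r \<le> V" "2 * r + 4 \<le> V" "Suc (2 + 2 * r) \<le> V" "2 * m \<le> V" "N \<le> V" "2 \<le> V" "1 \<le> V"
      "fst (E ! r) \<le> V" "snd (E ! r) \<le> V"
    using assms(1) n E_edge[OF assms(1)] by (auto simp: V_def)
  ultimately show ?thesis
    using assms input_nth(3,4)[OF assms(1)]
    by (cases "b = 0")
      (simp_all,
        (rule reaches_refl, simp; fail
         | rule reaches_step, rule space_ok, simp, simp, simp,
           simp add: run_simps del: exec.simps, simp)+)
qed

lemma run_next:
  assumes "bit_cells f" "\<forall>a \<in> {c, p, rem, cy, b, y, z}. a \<le> V" "rem > 1"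
  shows "run 3 (machine 29 [1, 2, 2 * m, N, c, p, rem, cy, b, y, z] f w)
    (machine 9 [1, 2, 2 * m, N, c, p, rem - 1, cy, b, y, z] f w)"
proof -
  have "2 * m \<le> V" "N \<le> V" "2 \<le> V" "1 \<le> V" "rem - 1 \<le> V" "\<not> rem \<le> 1"
    using assms n by (auto simp: V_def)
  then show ?thesis
    using assms
    by - (simp_all,
        (rule reaches_refl, simp; fail
         | rule reaches_step, rule space_ok, simp, simp, simp,
           simp add: run_simps del: exec.simps, simp)+)
qed

text \<open>Cell 1 is bit \<open>m - 1\<close> of the counter; while it is 0 another copy follows.
  Input position, column count and carry are reset, but the cell address is kept.\<close>

lemma run_next_block:
  assumes "bit_cells f" "\<forall>a \<in> {c, p, cy, b, y, z}. a \<le> V" "f 1 = 0"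
  shows "run 6 (machine 29 [1, 2, 2 * m, N, c, p, 1, cy, b, y, z] f w)
    (machine 9 [1, 2, 2 * m, N, c, 2, N, 1, b, y, z] f w)"
proof -
  have "2 * m \<le> V" "N \<le> V" "2 \<le> V" "1 \<le> V"
    using assms n by (auto simp: V_def)
  then show ?thesis
    using assms
    by - (simp_all,
        (rule reaches_refl, simp; fail
         | rule reaches_step, rule space_ok, simp, simp, simp,
           simp add: run_simps del: exec.simps, simp)+)
qed

lemma run_halt:
  assumes "bit_cells f" "\<forall>a \<in> {c, p, cy, b, y, z}. a \<le> V" "f 1 \<noteq> 0"
  shows "run 3 (machine 29 [1, 2, 2 * m, N, c, p, 1, cy, b, y, z] f w)
    (machine 33 [1, 2, 2 * m, N, c, p, 0, cy, b, y, z] f w)"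
proof -
  have "2 * m \<le> V" "N \<le> V" "2 \<le> V" "1 \<le> V"
    using assms n by (auto simp: V_def)
  then show ?thesis
    using assms
    by - (simp_all,
        (rule reaches_refl, simp; fail
         | rule reaches_step, rule space_ok, simp, simp, simp,
           simp add: run_simps del: exec.simps, simp)+)
qed

lemma initial_machine: "initial = machine 0 (replicate 11 0) (\<lambda>_. 0) []"
  by (auto simp: initial_def machine_def memory_def fun_eq_iff)

lemma run_init:
  "run 9 initial (machine 9 [1, 2, 2 * m, N, 2 * m, 2, N, 1, 0, 0, 0] (\<lambda>_. 0) [])"
proof -
  have "2 * m \<le> V" "N \<le> V" "2 \<le> V" "1 \<le> V" "n \<le> V" "n - 1 = 2 * m" "bit_cells (\<lambda>_. 0)"
    using n by (auto simp: V_def bit_cells_def)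
  moreover have "replicate 11 0 = [0,0,0,0,0,0,0,0,0,0,0::nat]"
    by (simp add: numeral_eq_Suc)
  moreover have pc_2: "machine (Suc (Suc 0)) = machine 2" by (simp add: numeral_2_eq_2)
  moreover have "length x > 1" "x \<noteq> []" by (simp_all add: length_input encode_input_def)
  ultimately show ?thesis
    unfolding initial_machine using input_nth(1,2)
    by - (simp_all,
        (rule reaches_refl, simp; fail
         | rule reaches_step, rule space_ok, simp, simp, simp,
           simp add: run_simps pc_2 del: exec.simps, simp)+)
qed

text \<open>Before column \<open>r\<close> of copy \<open>B\<close> the bits below \<open>r\<close> are already those of \<open>Suc B\<close>; the carry into bit \<open>r\<close> is 1 iff the \<open>r\<close> low bits of \<open>Suc B\<close> vanish, i.e. \<open>2 ^ r dvd Suc B\<close>. As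
  \<open>Suc B \<le> 2 ^ (m - 1)\<close>, this also gives carry 0 for all \<open>r \<ge> m\<close>.\<close>

definition cells :: "nat \<Rightarrow> nat \<Rightarrow> nat \<Rightarrow> nat" where
  "cells B r i =
     (if 1 \<le> i \<and> i \<le> m then (if m - i < r then Suc B else B) div 2 ^ (m - i) mod 2 else 0)"

lemma bit_cells_cells: "bit_cells (cells B r)"
proof -
  have "k mod 2 \<le> Suc 0" for k :: nat by presburger
  then show ?thesis by (simp add: bit_cells_def cells_def)
qed

section \<open>Output and counter from column to column\<close>

definition columns :: "nat \<Rightarrow> nat list" where
  "columns j = flatten_pairs (map (\<lambda>j. (T 0 j, T 1 j)) [0..<j])"

lemma columns_Suc: "columns (Suc j) = columns j @ [T 0 j, T 1 j]"
  by (simp add: columns_def flatten_pairs_def)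

text \<open>\<open>2 ^ r dvd Suc B\<close> says that the low \<open>r\<close> bits of
  \<open>B\<close> are all 1, so that the increment carries into bit \<open>r\<close>.\<close>

lemma bit_Suc:
  "Suc B div 2 ^ r mod 2 = (if 2 ^ r dvd Suc B then 1 - B div 2 ^ r mod 2 else B div 2 ^ r mod 2)"
proof (cases "2 ^ r dvd Suc B")
  case True
  then have "Suc B div 2 ^ r = Suc (B div 2 ^ r)"
    by (simp only: div_Suc dvd_eq_mod_eq_0 if_True simp_thms)
  moreover have "Suc k mod 2 = 1 - k mod 2" for k by presburger
  ultimately show ?thesis using True by presburger
next
  case False
  then have "Suc B div 2 ^ r = B div 2 ^ r"
    by (simp only: div_Suc dvd_eq_mod_eq_0 if_False simp_thms)
  then show ?thesis using False by presburger
qed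

text \<open>With \<open>b = Suc B\<close>: the carry passes bit \<open>r\<close> exactly when it
  arrives there and leaves a 0 behind.\<close>

lemma power_Suc_dvd_iff:
  "(2::nat) ^ Suc r dvd b \<longleftrightarrow> 2 ^ r dvd b \<and> b div 2 ^ r mod 2 = 0"
proof -
  have "b mod 2 ^ Suc r = 2 ^ r * (b div 2 ^ r mod 2) + b mod 2 ^ r"
    by (simp only: power_Suc2 mod_mult2_eq)
  then show ?thesis by (auto simp only: dvd_eq_mod_eq_0 add_is_0 mult_is_0 power_eq_0_iff)
qed

text \<open>The loop invariant at the head of the column loop; \<open>b\<close>, \<open>y\<close>,
  \<open>z\<close> are leftovers in the scratch registers.\<close>

definition column_state :: "nat \<Rightarrow> nat \<Rightarrow> nat \<Rightarrow> nat \<Rightarrow> config" where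
  "column_state j b y z =
     machine 9 [1, 2, 2 * m, N, 2 * (m - j mod N mod m), 2 + 2 * (j mod N), N - j mod N,
       of_bool (2 ^ (j mod N) dvd Suc (j div N)), b, y, z] (cells (j div N) (j mod N)) (columns j)"

text \<open>The loop body up to the column count, in 5 + 5 + 10 steps. The result is stated with
  \<open>Suc r\<close> because column \<open>Suc j\<close> may belong to the next copy.\<close>

lemma run_column:
  assumes "j < fact n div 2" "b \<le> V" "y \<le> V" "z \<le> V"
  defines "r \<equiv> j mod N" and "B \<equiv> j div N"
  shows "\<exists>b' \<le> V. \<exists>y' \<le> V. \<exists>z' \<le> V. run 20 (column_state j b y z)
    (machine 29 [1, 2, 2 * m, N, 2 * (m - Suc r mod m), 2 + 2 * Suc r, N - r,
       of_bool (2 ^ Suc r dvd Suc B), b', y', z'] (cells B (Suc r)) (columns (Suc j)))"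
proof -
  define q where "q = r mod m"
  define i where "i = m - q"
  define cy :: nat where "cy = of_bool (2 ^ r dvd Suc B)"
  let ?f = "cells B r"
  have q: "q < m" using m by (simp add: q_def)
  have i: "1 \<le> i" "i \<le> m" "m - i = q" using q by (auto simp: i_def)
  have r: "r < N" using N_pos by (simp add: r_def)
  have B: "B < 2 ^ (m - 1)"
    using assms(1) unfolding B_def width by (simp add: less_mult_imp_div_less)
  \<comment> \<open>A carry can only be alive during the first \<open>m\<close> columns, so later
    passes over the cells do not alter the counter.\<close>
  have early: "r < m" if "cy \<noteq> 0"
  proof -
    have "(2::nat) ^ r \<le> Suc B" using that by (intro dvd_imp_le) (auto simp: cy_def)
    also have "\<dots> \<le> 2 ^ (m - 1)" using B by simp
    finally have "r \<le> m - 1" by simp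
    then show ?thesis using m by simp
  qed
  have newbit: "Suc B div 2 ^ q mod 2 = (if cy = 0 then ?f i else 1 - ?f i)"
  proof (cases "r < m")
    case True
    then have "q = r" by (simp add: q_def)
    then show ?thesis using i by (simp add: cells_def cy_def bit_Suc)
  next
    case False
    then show ?thesis using early i q by (auto simp: cells_def)
  qed
  \<comment> \<open>Only the cell of bit \<open>r\<close> changes its role from \<open>B\<close> to
    \<open>Suc B\<close>; without a carry both have the same bit there.\<close>
  have newcells: "(if cy = 0 then ?f else ?f(i := 1 - ?f i)) = cells B (Suc r)"
  proof
    fix k
    show "(if cy = 0 then ?f else ?f(i := 1 - ?f i)) k = cells B (Suc r) k"
    proof (cases "1 \<le> k \<and> k \<le> m \<and> m - k = r")
      case True
      then have "q = r" "k = i" by (auto simp: q_def i_def)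
      then show ?thesis using newbit i by (simp add: cells_def)
    next
      case False
      then have "k \<noteq> i" if "cy \<noteq> 0" using early[OF that] i by (auto simp: q_def)
      then show ?thesis using False by (auto simp: cells_def less_Suc_eq)
    qed
  qed
  have newcarry: "(if cy = 0 then 0 else 1 - (1 - ?f i)) = of_bool (2 ^ Suc r dvd Suc B)"
  proof (cases "cy = 0")
    case False
    then have "q = r" using early by (simp add: q_def)
    moreover have "?f i \<le> 1" using bit_cells_cells by (simp add: bit_cells_def)
    ultimately show ?thesis
      using False newbit by (auto simp: power_Suc_dvd_iff cy_def simp del: power_Suc)
  qed (simp add: power_Suc_dvd_iff cy_def del: power_Suc)
  have last: "i = 1 \<longleftrightarrow> Suc q = m" using q by (auto simp: i_def)
  have newpos: "(if i = 1 then 2 * m else 2 * (i - 1)) = 2 * (m - Suc r mod m)"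
    unfolding last mod_Suc q_def[symmetric] by (simp add: i_def)
  let ?b = "if i = 1 then 0 else Suc B div 2 ^ q mod 2"
  have "swapped m N j \<longleftrightarrow> q < m - 1 \<and> odd (Suc B div 2 ^ q)"
    by (simp add: swapped_def q_def r_def B_def)
  \<comment> \<open>The bit forced to 0 at \<open>i = 1\<close> matches the condition
    \<open>q < m - 1\<close> in \<open>swapped\<close>.\<close>
  then have swap: "?b = of_bool (swapped m N j)"
    unfolding last using q by (auto simp: odd_iff_mod_2_eq_one)
  have out: "columns j @ (if ?b = 0 then [fst (E ! r), snd (E ! r)] else [snd (E ! r), fst (E ! r)]) =
      columns (Suc j)"
    unfolding swap by (simp add: columns_Suc torus_of_def r_def)
  have V: "2 + 2 * r \<le> V" "2 + 2 * Suc r \<le> V" "N - r \<le> V" "2 * m \<le> V" "1 \<le> V"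
      "fst (E ! r) \<le> V" "snd (E ! r) \<le> V"
    using r n E_edge[OF r] by (auto simp: V_def)
  have bV: "Suc B div 2 ^ q mod 2 \<le> V" "?b \<le> V"
    using V(5) mod_less_divisor[of 2 "Suc B div 2 ^ q"] by auto
  have state: "column_state j b y z =
      machine 9 [1, 2, 2 * m, N, 2 * i, 2 + 2 * r, N - r, cy, b, y, z] ?f (columns j)"
    unfolding column_state_def r_def B_def q_def i_def cy_def ..
  have "run 5 (column_state j b y z)
      (machine 14 [1, 2, 2 * m, N, 2 * i, 2 + 2 * r, N - r, if cy = 0 then 0 else 1 - (1 - ?f i),
         if cy = 0 then ?f i else 1 - ?f i, y, z]
         (if cy = 0 then ?f else ?f(i := 1 - ?f i)) (columns j))"
    unfolding state
    by (rule run_carry) (use i V assms(2-4) in \<open>auto simp: bit_cells_cells cy_def\<close>)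
  then have carry: "run 5 (column_state j b y z)
      (machine 14 [1, 2, 2 * m, N, 2 * i, 2 + 2 * r, N - r, of_bool (2 ^ Suc r dvd Suc B),
         Suc B div 2 ^ q mod 2, y, z] (cells B (Suc r)) (columns j))"
    unfolding newcells newcarry newbit[symmetric] .
  have position: "run 5
    (machine 14 [1, 2, 2 * m, N, 2 * i, 2 + 2 * r, N - r, of_bool (2 ^ Suc r dvd Suc B),
         Suc B div 2 ^ q mod 2, y, z] (cells B (Suc r)) (columns j))
    (machine 19 [1, 2, 2 * m, N, 2 * (m - Suc r mod m), 2 + 2 * r, N - r,
      of_bool (2 ^ Suc r dvd Suc B), ?b, y, z] (cells B (Suc r)) (columns j))"
    unfolding newpos[symmetric]
    by (rule run_position) (use i V bV assms(2-4) in \<open>auto simp: bit_cells_cells\<close>)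
  have emit: "run 10
    (machine 19 [1, 2, 2 * m, N, 2 * (m - Suc r mod m), 2 + 2 * r, N - r,
      of_bool (2 ^ Suc r dvd Suc B), ?b, y, z] (cells B (Suc r)) (columns j))
    (machine 29 [1, 2, 2 * m, N, 2 * (m - Suc r mod m), 2 + 2 * Suc r, N - r,
      of_bool (2 ^ Suc r dvd Suc B), ?b, fst (E ! r), snd (E ! r)]
      (cells B (Suc r)) (columns (Suc j)))"
    unfolding out[symmetric]
    by (rule run_output) (use r V bV assms(2-4) in \<open>auto simp: bit_cells_cells\<close>)
  have "run 10 (column_state j b y z)
    (machine 19 [1, 2, 2 * m, N, 2 * (m - Suc r mod m), 2 + 2 * r, N - r,
      of_bool (2 ^ Suc r dvd Suc B), ?b, y, z] (cells B (Suc r)) (columns j))"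
    using carry position by (rule reaches_trans) simp
  from reaches_trans[OF this emit, of 20]
  show ?thesis using V(6,7) bV(2) by (intro exI conjI) simp_all
qed

text \<open>The setup takes 9 steps, and a column costs at most 20 for its body plus 6 for the
  transition to the next one.\<close>

lemma run_to_column:
  "j < fact n div 2 \<Longrightarrow>
     \<exists>b \<le> V. \<exists>y \<le> V. \<exists>z \<le> V. run (9 + 26 * j) initial (column_state j b y z)"
proof (induction j)
  case 0
  have "cells 0 0 = (\<lambda>_. 0)" by (auto simp: cells_def)
  then have "column_state 0 0 0 0 = machine 9 [1, 2, 2 * m, N, 2 * m, 2, N, 1, 0, 0, 0] (\<lambda>_. 0) []"
    by (simp add: column_state_def columns_def flatten_pairs_def)
  then show ?case using run_init by (intro exI[of _ 0] conjI) simp_all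
next
  case (Suc j)
  let ?r = "j mod N" and ?B = "j div N"
  let ?cy = "of_bool (2 ^ Suc ?r dvd Suc ?B) :: nat"
  obtain b y z where byz: "b \<le> V" "y \<le> V" "z \<le> V"
      and IH: "run (9 + 26 * j) initial (column_state j b y z)"
    using Suc by auto
  obtain b' y' z' where byz': "b' \<le> V" "y' \<le> V" "z' \<le> V"
      and col: "run 20 (column_state j b y z)
        (machine 29 [1, 2, 2 * m, N, 2 * (m - Suc ?r mod m), 2 + 2 * Suc ?r, N - ?r, ?cy, b', y', z']
          (cells ?B (Suc ?r)) (columns (Suc j)))" (is "run _ _ ?c")
    using run_column[OF _ byz] Suc.prems by (meson Suc_lessD)
  have r: "?r < N" using N_pos by simp
  have V: "\<forall>a \<in> {2 * (m - Suc ?r mod m), 2 + 2 * Suc ?r, N - ?r, ?cy, b', y', z'}. a \<le> V"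
    using r byz' by (auto simp: V_def)
  have "run 6 ?c (column_state (Suc j) b' y' z')"
  proof (cases "Suc ?r < N")
    case True
    then have "Suc j mod N = Suc ?r" "Suc j div N = ?B"
      by (simp_all add: mod_Suc div_Suc)
    then have "column_state (Suc j) b' y' z' =
        machine 9 [1, 2, 2 * m, N, 2 * (m - Suc ?r mod m), 2 + 2 * Suc ?r, N - ?r - 1, ?cy, b', y', z']
          (cells ?B (Suc ?r)) (columns (Suc j))"
      unfolding column_state_def by simp
    moreover have "run 3 ?c \<dots>"
      by (rule run_next) (use V True in \<open>auto simp: bit_cells_cells\<close>)
    ultimately have "run 3 ?c (column_state (Suc j) b' y' z')" by (simp only:)
    then show ?thesis by (rule reaches_mono) simp
  next
    case False
    then have last: "Suc ?r = N" using r by simp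
    then have next_block: "Suc j mod N = 0" "Suc j div N = Suc ?B"
      by (simp_all add: mod_Suc div_Suc)
    \<comment> \<open>Another column remains, so the incremented counter has not reached bit
      \<open>m - 1\<close> and the program goes on.\<close>
    then have "Suc ?B < 2 ^ (m - 1)"
      using Suc.prems N_pos less_mult_imp_div_less unfolding width by metis
    then have "cells ?B (Suc ?r) 1 = 0"
      using m m_le_N by (simp add: cells_def last)
    \<comment> \<open>As \<open>m \<le> N\<close>, every bit has been updated by the end of the
      copy.\<close>
    moreover have "cells ?B (Suc ?r) = cells (Suc ?B) 0"
      using m_le_N by (auto simp: cells_def last fun_eq_iff)
    moreover have "Suc ?r mod m = 0" using m_dvd_N by (simp add: last)
    moreover have "N - ?r = 1" using last by simp
    ultimately show ?thesis
      using run_next_block[of "cells ?B (Suc ?r)" "2 * (m - Suc ?r mod m)" "2 + 2 * Suc ?r" ?cy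
          b' y' z' "columns (Suc j)"] V
      by (simp add: column_state_def next_block bit_cells_cells del: mult_Suc_right)
  qed
  with col have "run 26 (column_state j b y z) (column_state (Suc j) b' y' z')"
    by (rule reaches_trans) simp
  with IH have "run (9 + 26 * Suc j) initial (column_state (Suc j) b' y' z')"
    by (rule reaches_trans) simp
  then show ?case using byz' by blast
qed

text \<open>The last column is followed by the halting branch: with \<open>j + 1\<close> columns the
  total is at most \<open>9 + 26 * j + 23\<close>, which is below
  \<open>40 * (j + 1)\<close>.\<close>

lemma run_torus_program:
  "outputs_within torus_program x (flatten_pairs (torus_columns n T)) (40 * (fact n div 2)) space_bound"
proof -
  define j where "j = fact n div 2 - (1::nat)"
  have "fact n div 2 > (0::nat)"
    using N_pos by (simp add: width)
  then have j: "j < fact n div 2" "Suc j = fact n div 2" by (simp_all add: j_def)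
  let ?r = "j mod N" and ?B = "j div N"
  let ?cy = "of_bool (2 ^ Suc ?r dvd Suc ?B) :: nat"
  have "Suc j = 2 ^ (m - 1) * N" using j(2) width by simp
  then have "Suc j mod N = 0" "Suc j div N = 2 ^ (m - 1)" using N_pos by simp_all
  then have last: "Suc ?r = N" "Suc ?B = 2 ^ (m - 1)"
    by (simp_all add: mod_Suc div_Suc split: if_splits)
  obtain b y z where byz: "b \<le> V" "y \<le> V" "z \<le> V"
      and start: "run (9 + 26 * j) initial (column_state j b y z)"
    using run_to_column[OF j(1)] by blast
  obtain b' y' z' where byz': "b' \<le> V" "y' \<le> V" "z' \<le> V"
      and col: "run 20 (column_state j b y z)
        (machine 29 [1, 2, 2 * m, N, 2 * (m - Suc ?r mod m), 2 + 2 * Suc ?r, N - ?r, ?cy, b', y', z']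
          (cells ?B (Suc ?r)) (columns (Suc j)))" (is "run _ _ ?c")
    using run_column[OF j(1) byz] by blast
  have V: "\<forall>a \<in> {2 * (m - Suc ?r mod m), 2 + 2 * Suc ?r, ?cy, b', y', z'}. a \<le> V"
    using last(1) byz' by (auto simp: V_def)
  define h where "h =
    machine 33 [1, 2, 2 * m, N, 2 * (m - Suc ?r mod m), 2 + 2 * Suc ?r, 0, ?cy, b', y', z']
      (cells ?B (Suc ?r)) (columns (Suc j))"
  have "N - ?r = 1" using last(1) by simp
  \<comment> \<open>In the last copy the counter becomes \<open>2 ^ (m - 1)\<close>, whose bit
    \<open>m - 1\<close> is set.\<close>
  moreover have "cells ?B (Suc ?r) 1 \<noteq> 0"
    using m m_le_N by (simp add: cells_def last)
  ultimately have "run 3 ?c h"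
    unfolding h_def by (simp only:) (rule run_halt, use V in \<open>auto simp: bit_cells_cells\<close>)
  with col have "run 23 (column_state j b y z) h"
    by (rule reaches_trans) simp
  with start have "run (40 * (fact n div 2)) initial h"
    by (rule reaches_trans) (simp add: j(2)[symmetric])
  then obtain t where t: "t \<le> 40 * (fact n div 2)" "config_at torus_program x t = h"
      "\<forall>s < t. space_used (config_at torus_program x s) \<le> space_bound"
    by (auto simp: reaches_def config_at_def)
  have "space_used h \<le> space_bound"
    unfolding h_def
    by (rule space_ok) (use V in \<open>auto simp: V_def bit_cells_cells\<close>)
  then have "\<forall>s \<le> t. space_used (config_at torus_program x s) \<le> space_bound"
    using t(2,3) by (metis le_neq_implies_less)
  moreover have "halted torus_program h"
    by (simp add: halted_def h_def machine_def length_torus_program)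
  moreover have "written h = flatten_pairs (torus_columns n T)"
    by (simp add: h_def machine_def columns_def torus_columns_def j(2))
  ultimately show ?thesis
    unfolding outputs_within_def using t(1,2) by blast
qed

text \<open>\<open>V\<close> may be as large as a factorial, but only its binary length is charged:
  from \<open>N \<le> fact n \<le> n ^ n \<le> 2 ^ (n * n)\<close> this length is at most quadratic
  in \<open>n\<close>.\<close>

lemma space_bound_le: "space_bound \<le> poly ([:22, 1:] * [:24, 1, 1:]) n"
proof -
  have "N \<le> N * 2 ^ m" by simp
  also have "\<dots> = fact n" by (rule N_eq)
  also have "\<dots> \<le> n ^ n" using fact_le_power[of n, where 'a = nat] by simp
  also have "\<dots> \<le> (2 ^ n) ^ n" by (intro power_mono) (simp_all add: less_imp_le)
  finally have N: "N \<le> 2 ^ (n * n)" by (simp add: power_mult)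
  have "n < 2 ^ n" by simp
  also have "(2::nat) ^ n \<le> 2 ^ (n * n)" using n by (intro power_increasing) auto
  finally have "n < 2 ^ (n * n)" .
  then have "V < 2 ^ (n * n + 3)"
    using N n by (simp add: V_def power_add)
  then have "floorlog 2 V \<le> n * n + 3"
    by (intro floorlog_leI) simp_all
  moreover have "space_bound = (n + 22) * (n + 21 + floorlog 2 V)"
    using n by (simp add: space_bound_def)
  ultimately have "space_bound \<le> (n + 22) * (n + 21 + (n * n + 3))"
    by (simp only: mult_le_mono2 add_le_mono order_refl)
  then show ?thesis by (simp add: algebra_simps)
qed

end

theorem theorem17:
  "\<exists>(P :: program) (C :: nat) (p :: nat poly).
     \<forall>(m :: nat) (n :: nat) (E :: (nat \<times> nat) list).
       m \<ge> 1 \<longrightarrow> n = 2 * m + 1 \<longrightarrow> universal_cycle m n (edges_of E) \<longrightarrow>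
       (\<exists>T. shorthand_universal_torus m n T \<and>
            outputs_within P (encode_input n E) (flatten_pairs (torus_columns n T))
              (C * (fact n div 2)) (poly p n))"
proof (intro exI allI impI conjI)
  fix m n :: nat and E :: "(nat \<times> nat) list"
  assume "m \<ge> 1" "n = 2 * m + 1" "universal_cycle m n (edges_of E)"
  then interpret matching_cycle m n E by unfold_locales
  show "shorthand_universal_torus m n (torus_of m E)"
    by (rule torus_of_universal)
  show "outputs_within torus_program (encode_input n E) (flatten_pairs (torus_columns n (torus_of m E)))
      (40 * (fact n div 2)) (poly ([:22, 1:] * [:24, 1, 1:]) n)"
    using run_torus_program space_bound_le unfolding outputs_within_def by (meson le_trans)
qed

end
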